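(* There exist irrational numbers $\alpha\in\mathbb{R}/\mathbb{Z}$ for which $$\liminf_{r\to\infty}\frac{\log\mathscr{B}_\alpha(r)}{\log r}=0<\frac12=\limsup_{r\to\infty}\frac{\log\mathscr{B}_\alpha(r)}{\log r}.$$
   Context: Fix $\varepsilon$ with $0<\varepsilon\le\varepsilon_4$, where $\varepsilon_4>0$ is the Margulis constant of hyperbolic 4-space $\mathbb{H}^4$, and put $c(\varepsilon)=1/\sqrt{2\cosh(\varepsilon)-2}$. For irrational $\alpha\in\mathbb{R}/\mathbb{Z}$ the boundary function $\mathscr{B}_\alpha:[0,\infty)\to\mathbb{R}$ is $$\mathscr{B}_\alpha(r)=\inf_{j\ge1}c(\varepsilon)\sqrt{4\sin^2(\pi j\alpha)\,r^2+j^2},$$ the infimum being over integers $j\ge1$. *)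

theory Defs
  imports "HOL-Analysis.Analysis" "HOL-Algebra.Algebra"
begin

section \<open>Hyperbolic 4-space: the upper half-space model\<close>

text \<open>Points are pairs \<open>(x, t)\<close> with \<open>x\<close> in three-dimensional Euclidean space and height \<open>t > 0\<close>.
  The distance on pairs is the Euclidean one, so \<open>hyp4_dist\<close> is given by the usual formula
  \<open>cosh d = 1 + |p - q|^2 / (2 s t)\<close>, where \<open>s\<close> and \<open>t\<close> are the heights of \<open>p\<close> and \<open>q\<close>.\<close>

type_synonym half_space_point = "(real ^ 3) \<times> real"

definition hyp4 :: "half_space_point set" where
  "hyp4 = {p. snd p > 0}"

definition hyp4_dist :: "half_space_point \<Rightarrow> half_space_point \<Rightarrow> real" where
  "hyp4_dist p q = arcosh (1 + (dist p q)\<^sup>2 / (2 * snd p * snd q))"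

text \<open>All isometries are allowed, including the orientation-reversing ones. Elements of \<open>Bij hyp4\<close>
  are extensional, so two isometries are equal iff they agree on \<open>hyp4\<close>.\<close>

definition hyp4_isometries :: "(half_space_point \<Rightarrow> half_space_point) set" where
  "hyp4_isometries =
     {g \<in> Bij hyp4. \<forall>p\<in>hyp4. \<forall>q\<in>hyp4. hyp4_dist (g p) (g q) = hyp4_dist p q}"

text \<open>Discreteness refers to the compact-open topology: a subgroup is discrete iff the
  identity is isolated in it.\<close>

definition discrete_isometry_group :: "(half_space_point \<Rightarrow> half_space_point) set \<Rightarrow> bool" where
  "discrete_isometry_group \<Gamma> \<longleftrightarrow>
     subgroup \<Gamma> (BijGroup hyp4) \<and> \<Gamma> \<subseteq> hyp4_isometries \<and>
     (\<exists>K \<delta>. compact K \<and> K \<subseteq> hyp4 \<and> \<delta> > 0 \<and>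
        (\<forall>g\<in>\<Gamma>. (\<forall>p\<in>K. hyp4_dist p (g p) < \<delta>) \<longrightarrow> g = \<one>\<^bsub>BijGroup hyp4\<^esub>))"


section \<open>Virtually nilpotent groups\<close>

primrec lower_central :: "('a, 'b) monoid_scheme \<Rightarrow> nat \<Rightarrow> 'a set" where
  "lower_central G 0 = carrier G"
| "lower_central G (Suc n) =
     generate G {x \<otimes>\<^bsub>G\<^esub> y \<otimes>\<^bsub>G\<^esub> inv\<^bsub>G\<^esub> x \<otimes>\<^bsub>G\<^esub> inv\<^bsub>G\<^esub> y |x y. x \<in> carrier G \<and> y \<in> lower_central G n}"

definition nilpotent_group :: "('a, 'b) monoid_scheme \<Rightarrow> bool" where
  "nilpotent_group G \<longleftrightarrow> group G \<and> (\<exists>n. lower_central G n = {\<one>\<^bsub>G\<^esub>})"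

definition virtually_nilpotent :: "('a, 'b) monoid_scheme \<Rightarrow> bool" where
  "virtually_nilpotent G \<longleftrightarrow> group G \<and>
     (\<exists>N. subgroup N G \<and> finite (rcosets\<^bsub>G\<^esub> N) \<and> nilpotent_group (G\<lparr>carrier := N\<rparr>))"


section \<open>The Margulis constant\<close>

definition small_displacement_group ::
    "(half_space_point \<Rightarrow> half_space_point) set \<Rightarrow> real \<Rightarrow> half_space_point \<Rightarrow>
     (half_space_point \<Rightarrow> half_space_point) set" where
  "small_displacement_group \<Gamma> \<epsilon> p =
     generate (BijGroup hyp4) {g \<in> \<Gamma>. hyp4_dist p (g p) < \<epsilon>}"

definition margulis_number :: "real \<Rightarrow> bool" where
  "margulis_number \<epsilon> \<longleftrightarrow> \<epsilon> > 0 \<and>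
     (\<forall>\<Gamma> p. discrete_isometry_group \<Gamma> \<longrightarrow> p \<in> hyp4 \<longrightarrow>
        virtually_nilpotent ((BijGroup hyp4)\<lparr>carrier := small_displacement_group \<Gamma> \<epsilon> p\<rparr>))"

text \<open>The set of Margulis numbers is nonempty by the Margulis lemma and bounded above because
  there are discrete, finitely generated groups that are not virtually nilpotent; so this real
  supremum is the genuine one. With the strict inequality in \<open>small_displacement_group\<close> it
  is itself a Margulis number: by discreteness only finitely many elements displace a given
  point by less than a given bound.\<close>

definition margulis_constant4 :: real where
  "margulis_constant4 = Sup {\<epsilon>. margulis_number \<epsilon>}"


section \<open>The boundary function\<close>

definition cusp_const :: "real \<Rightarrow> real" where
  "cusp_const \<epsilon> = 1 / sqrt (2 * cosh \<epsilon> - 2)"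

definition boundary_fun :: "real \<Rightarrow> real \<Rightarrow> real \<Rightarrow> real" where
  "boundary_fun \<epsilon> \<alpha> r =
     (INF j\<in>{1::nat..}. cusp_const \<epsilon> * sqrt (4 * (sin (pi * real j * \<alpha>))\<^sup>2 * r\<^sup>2 + (real j)\<^sup>2))"

text \<open>The boundary function depends only on the class of \<open>\<alpha>\<close> modulo the integers.\<close>

lemma boundary_fun_add_int: "boundary_fun \<epsilon> (\<alpha> + of_int k) r = boundary_fun \<epsilon> \<alpha> r"
proof -
  have "(sin (pi * real j * (\<alpha> + of_int k)))\<^sup>2 = (sin (pi * real j * \<alpha>))\<^sup>2" for j :: nat
  proof -
    define m where "m = int j * k"
    have eq: "pi * real j * (\<alpha> + of_int k) = pi * real j * \<alpha> + pi * of_int m"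
      by (simp add: m_def algebra_simps)
    have s: "sin (pi * of_int m) = 0"
      by (simp add: sin_zero_iff_int2 mult.commute)
    then have "(cos (pi * of_int m))\<^sup>2 = 1"
      using sin_cos_squared_add[of "pi * of_int m"] by simp
    then show ?thesis
      unfolding eq sin_add s by (simp add: power_mult_distrib)
  qed
  then show ?thesis
    by (simp add: boundary_fun_def)
qed

end

theory Submission
  imports Defs
begin

text \<open>
  Write \<open>B\<close> for the boundary function, \<open>c > 0\<close> for its constant \<open>cusp_const \<epsilon>\<close> and
  \<open>\<parallel>x\<parallel>\<close> for the distance from \<open>x\<close> to the nearest integer. Since
  \<open>2 \<parallel>x\<parallel> \<le> \<bar>sin (\<pi> x)\<bar> \<le> \<pi> \<parallel>x\<parallel>\<close>, the value \<open>B r\<close> is, up to constant factors, the infimum over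
  \<open>j \<ge> 1\<close> of \<open>max (r \<parallel>j \<alpha>\<parallel>) j\<close>: it measures how well \<open>\<alpha>\<close> is approximated by fractions
  with denominators up to \<open>B r\<close>. The growth exponent of \<open>B\<close> is therefore a question of Diophantine
  approximation.

  Two bounds hold for every \<open>\<alpha>\<close>. All terms are at least \<open>c\<close>, so the lower exponent is nonnegative;
  and Dirichlet's theorem provides a \<open>j\<close> of size about \<open>sqrt r\<close> with \<open>\<parallel>j \<alpha>\<parallel> \<le> 1 / sqrt r\<close>, so
  \<open>B r\<close> is at most a constant times \<open>sqrt r\<close> and the upper exponent is at most \<open>1/2\<close>.

  Both bounds are attained at a Liouville number. Let \<open>p/q\<close> be a reduced fraction close to \<open>\<alpha>\<close>.

  \<^item> If \<open>\<bar>\<alpha> - p/q\<bar> \<le> 1 / (2 q\<^sup>2)\<close>, then no \<open>j < q\<close> approximates well: \<open>\<parallel>j p/q\<parallel> \<ge> 1/q\<close> forces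
    \<open>\<parallel>j \<alpha>\<parallel> \<ge> 1/(2q)\<close>. At \<open>r = q\<^sup>2\<close> the terms with \<open>j < q\<close> are then at least \<open>2 c q\<close>, the others at
    least \<open>c q\<close>, so \<open>B r \<ge> c sqrt r\<close> (\<open>boundary_fun_square_ge\<close>).
  \<^item> If \<open>\<bar>\<alpha> - p/q\<bar> \<le> 1 / q^(n + 2)\<close>, then at \<open>r = q^(n + 1)\<close> the single term \<open>j = q\<close> shows that \<open>B r\<close>
    is at most a constant times \<open>q\<close>, so the exponent at \<open>r\<close> is at most of order \<open>1/(n + 1)\<close>
    (\<open>Liminf_boundary_exponent_le\<close>).

  The number \<open>\<Sum>i\<ge>1. 2^(-i!)\<close> has such fractions with arbitrarily large \<open>q\<close> for every \<open>n\<close>, namely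
  its partial sums. Its irrationality comes for free: at a rational number with denominator \<open>b\<close> the term \<open>j = b\<close> bounds
  \<open>B\<close>, which is incompatible with a positive upper exponent.
\<close>

section \<open>The sine and the distance to the nearest integer\<close>

text \<open>Concavity puts the sine above its chord from \<open>0\<close> to \<open>\<pi>/2\<close>.\<close>
lemma two_mult_le_sin_pi:
  fixes y :: real
  assumes "0 \<le> y" "y \<le> 1/2"
  shows "2 * y \<le> sin (pi * y)"
proof -
  have "concave_on {0..pi} sin"
    by (rule f''_le0_imp_concave[where f' = cos and f'' = "\<lambda>x. - sin x"])
      (auto intro!: derivative_eq_intros sin_ge_zero)
  from concave_onD[OF this, of "2 * y" 0 "pi / 2"] assms
  show ?thesis by (simp add: mult_ac)
qed

lemma abs_sin_pi_of_int_diff: "\<bar>sin (pi * (x - of_int m))\<bar> = \<bar>sin (pi * x)\<bar>"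
proof -
  have "\<bar>cos (pi * of_int m)\<bar> = 1"
    by (metis abs_1 abs_minus_cancel cos_npi_int)
  then show ?thesis by (simp add: right_diff_distrib sin_diff abs_mult)
qed

text \<open>Subtracting the nearest integer moves \<open>x\<close> into the range of the chord bound. The distance to
  the nearest integer enters as an arbitrary lower bound \<open>d\<close> for the distances to all integers,
  which is the form in which it is estimated later.\<close>
lemma abs_sin_pi_ge:
  fixes x d :: real
  assumes "\<And>m::int. d \<le> \<bar>x - of_int m\<bar>"
  shows "2 * d \<le> \<bar>sin (pi * x)\<bar>"
proof -
  define y where "y = x - of_int (round x)"
  have d: "2 * d \<le> 2 * \<bar>y\<bar>" using assms[of "round x"] by (simp add: y_def)
  have "\<bar>y\<bar> \<le> 1/2"
    using of_int_round_abs_le[of x] by (simp add: y_def abs_minus_commute)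
  then have "2 * \<bar>y\<bar> \<le> sin (pi * \<bar>y\<bar>)" by (intro two_mult_le_sin_pi) auto
  also have "\<dots> \<le> \<bar>sin (pi * y)\<bar>" by (cases "y \<ge> 0") auto
  also have "\<dots> = \<bar>sin (pi * x)\<bar>" unfolding y_def by (rule abs_sin_pi_of_int_diff)
  finally show ?thesis using d by (rule order_trans[rotated])
qed

lemma abs_sin_pi_le: "\<bar>sin (pi * x)\<bar> \<le> pi * \<bar>x - of_int m\<bar>"
  using abs_sin_x_le_abs_x[of "pi * (x - of_int m)"]
  unfolding abs_sin_pi_of_int_diff by (simp add: abs_mult)

section \<open>Bounds for the boundary function\<close>

lemma cusp_const_pos:
  assumes "0 < \<epsilon>"
  shows "0 < cusp_const \<epsilon>"
proof -
  have "cosh 0 < cosh \<epsilon>" using assms by (subst cosh_real_nonneg_less_iff) auto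
  then show ?thesis by (simp add: cusp_const_def)
qed

lemma boundary_fun_le_term:
  assumes "0 < \<epsilon>" "1 \<le> j"
  shows "boundary_fun \<epsilon> \<alpha> r
    \<le> cusp_const \<epsilon> * sqrt (4 * (sin (pi * real j * \<alpha>))\<^sup>2 * r\<^sup>2 + (real j)\<^sup>2)"
  unfolding boundary_fun_def
  using assms cusp_const_pos[OF assms(1)]
  by (intro cINF_lower bdd_belowI2[where m = 0]) auto

text \<open>Any fraction \<open>h/j\<close> near \<open>\<alpha>\<close> bounds the boundary function from above. Replacing the root by
  a sum costs only a constant factor, invisible to the growth exponent.\<close>
lemma boundary_fun_le:
  assumes "0 < \<epsilon>" "1 \<le> j" "0 \<le> r"
  shows "boundary_fun \<epsilon> \<alpha> r
    \<le> cusp_const \<epsilon> * (2 * pi * \<bar>real j * \<alpha> - of_int h\<bar> * r + real j)"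
proof -
  let ?s = "2 * \<bar>sin (pi * (real j * \<alpha>))\<bar> * r"
  have "sqrt (4 * (sin (pi * real j * \<alpha>))\<^sup>2 * r\<^sup>2 + (real j)\<^sup>2) = sqrt (?s\<^sup>2 + (real j)\<^sup>2)"
    by (simp add: power_mult_distrib mult.assoc)
  also have "\<dots> \<le> ?s + real j"
    using assms by (intro sqrt_sum_squares_le_sum) auto
  also have "\<dots> \<le> 2 * (pi * \<bar>real j * \<alpha> - of_int h\<bar>) * r + real j"
    using assms by (intro add_mono mult_right_mono mult_left_mono abs_sin_pi_le) auto
  finally have "sqrt (4 * (sin (pi * real j * \<alpha>))\<^sup>2 * r\<^sup>2 + (real j)\<^sup>2)
      \<le> 2 * pi * \<bar>real j * \<alpha> - of_int h\<bar> * r + real j"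
    by (simp only: mult.assoc)
  from mult_left_mono[OF this less_imp_le[OF cusp_const_pos[OF assms(1)]]]
  show ?thesis by (rule order_trans[OF boundary_fun_le_term[OF assms(1,2)]])
qed

text \<open>The root dominates each of the two quantities under it, so to bound the infimum from below
  it suffices that for each \<open>j\<close> one of them is large.\<close>
lemma le_boundary_fun:
  assumes "0 < \<epsilon>"
    and "\<And>j. 1 \<le> j \<Longrightarrow> b \<le> 2 * \<bar>sin (pi * (real j * \<alpha>))\<bar> * r \<or> b \<le> real j"
    and "0 \<le> r"
  shows "cusp_const \<epsilon> * b \<le> boundary_fun \<epsilon> \<alpha> r"
  unfolding boundary_fun_def
proof (intro cINF_greatest mult_left_mono)
  fix j :: nat
  assume "j \<in> {1..}"
  let ?s = "2 * \<bar>sin (pi * (real j * \<alpha>))\<bar> * r"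
  have "?s \<le> sqrt (?s\<^sup>2 + (real j)\<^sup>2)" "real j \<le> sqrt (?s\<^sup>2 + (real j)\<^sup>2)"
    by simp_all
  moreover have "sqrt (4 * (sin (pi * real j * \<alpha>))\<^sup>2 * r\<^sup>2 + (real j)\<^sup>2)
      = sqrt (?s\<^sup>2 + (real j)\<^sup>2)"
    by (simp add: power_mult_distrib mult.assoc)
  moreover have "b \<le> ?s \<or> b \<le> real j"
    using assms(2)[of j] \<open>j \<in> {1..}\<close> by auto
  ultimately show "b \<le> sqrt (4 * (sin (pi * real j * \<alpha>))\<^sup>2 * r\<^sup>2 + (real j)\<^sup>2)"
    by linarith
qed (use cusp_const_pos[OF assms(1)] in auto)

lemma cusp_const_le_boundary_fun:
  assumes "0 < \<epsilon>" "0 \<le> r"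
  shows "cusp_const \<epsilon> \<le> boundary_fun \<epsilon> \<alpha> r"
  using le_boundary_fun[of \<epsilon> 1 \<alpha> r] assms by simp

lemma boundary_fun_pos:
  assumes "0 < \<epsilon>" "0 \<le> r"
  shows "0 < boundary_fun \<epsilon> \<alpha> r"
  using cusp_const_le_boundary_fun[OF assms, of \<alpha>] cusp_const_pos[OF assms(1)] by linarith

text \<open>Dirichlet's theorem with denominators up to about \<open>sqrt r\<close>, the choice that balances the two
  summands in \<open>boundary_fun_le\<close>.\<close>
lemma boundary_fun_le_sqrt:
  assumes "0 < \<epsilon>" "1 \<le> r"
  shows "boundary_fun \<epsilon> \<alpha> r \<le> cusp_const \<epsilon> * (2 * pi + 2) * sqrt r"
proof -
  define N where "N = nat \<lceil>sqrt r\<rceil>"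
  have r: "1 \<le> sqrt r" using assms by simp
  have N: "sqrt r \<le> real N" "real N \<le> 2 * sqrt r" "0 < N"
    using r unfolding N_def by linarith+
  obtain h k where k: "0 < k" "k \<le> int N" "\<bar>of_int k * \<alpha> - of_int h\<bar> < 1 / real N"
    using Dirichlet_approx[OF N(3)] by blast
  define j where "j = nat k"
  have j: "1 \<le> j" "real j \<le> real N" "\<bar>real j * \<alpha> - of_int h\<bar> \<le> 1 / sqrt r"
  proof -
    show "1 \<le> j" "real j \<le> real N" using k by (auto simp: j_def)
    have "1 / real N \<le> 1 / sqrt r" using N(1) r by (intro frac_le) auto
    then show "\<bar>real j * \<alpha> - of_int h\<bar> \<le> 1 / sqrt r" using k by (simp add: j_def)
  qed
  have "2 * pi * \<bar>real j * \<alpha> - of_int h\<bar> * r + real j \<le> 2 * pi * (1 / sqrt r) * r + 2 * sqrt r"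
    using assms j N by (intro add_mono mult_right_mono mult_left_mono) auto
  also have "\<dots> = (2 * pi + 2) * sqrt r"
    using r assms by (simp add: field_simps real_div_sqrt)
  finally have "2 * pi * \<bar>real j * \<alpha> - of_int h\<bar> * r + real j \<le> (2 * pi + 2) * sqrt r" .
  from mult_left_mono[OF this less_imp_le[OF cusp_const_pos[OF assms(1)]]]
  have "cusp_const \<epsilon> * (2 * pi * \<bar>real j * \<alpha> - of_int h\<bar> * r + real j)
      \<le> cusp_const \<epsilon> * (2 * pi + 2) * sqrt r" by (simp only: mult.assoc)
  then show ?thesis
    by (rule order_trans[OF boundary_fun_le[OF assms(1) j(1)], rotated]) (use assms in simp)
qed

text \<open>For \<open>0 < j < q\<close> the fraction \<open>j p/q\<close> is not an integer, because \<open>p/q\<close> is reduced, and so it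
  has distance at least \<open>1/q\<close> from every integer. Passing from \<open>p/q\<close> to \<open>\<alpha>\<close> changes \<open>j p/q\<close> by
  less than half of this. The terms with \<open>j \<ge> q\<close> are large on account of \<open>j\<close> alone.\<close>
lemma boundary_fun_square_ge:
  fixes q :: nat and p :: int
  assumes "0 < \<epsilon>" "0 < q" "coprime p (int q)"
    and approx: "\<bar>\<alpha> - of_int p / real q\<bar> \<le> 1 / (2 * (real q)\<^sup>2)"
  shows "cusp_const \<epsilon> * real q \<le> boundary_fun \<epsilon> \<alpha> ((real q)\<^sup>2)"
proof (rule le_boundary_fun[OF assms(1)])
  fix j :: nat
  assume "1 \<le> j"
  show "real q \<le> 2 * \<bar>sin (pi * (real j * \<alpha>))\<bar> * (real q)\<^sup>2 \<or> real q \<le> real j"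
  proof (cases "j < q")
    case True
    have "1 / (2 * real q) \<le> \<bar>real j * \<alpha> - of_int m\<bar>" for m :: int
    proof -
      have "int j * p \<noteq> m * int q"
      proof
        assume "int j * p = m * int q"
        then have "int q dvd int j"
          using assms(3) by (metis coprime_commute coprime_dvd_mult_left_iff dvd_triv_right)
        then show False using True \<open>1 \<le> j\<close> by (auto dest: dvd_imp_le)
      qed
      then have "1 \<le> \<bar>int j * p - m * int q\<bar>" by linarith
      then have "real_of_int 1 \<le> of_int \<bar>int j * p - m * int q\<bar>" by (simp only: of_int_le_iff)
      then have "1 \<le> \<bar>real j * of_int p - of_int m * real q\<bar>" by simp
      then have "1 / real q \<le> \<bar>real j * of_int p - of_int m * real q\<bar> / real q"
        by (simp add: divide_right_mono)
      also have "\<dots> = \<bar>real j * (of_int p / real q) - of_int m\<bar>"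
      proof -
        have "real j * (of_int p / real q) - of_int m = (real j * of_int p - of_int m * real q) / real q"
          using assms(2) by (simp add: field_simps)
        then show ?thesis by simp
      qed
      finally have 1: "1 / real q \<le> \<bar>real j * (of_int p / real q) - of_int m\<bar>" .
      have "\<bar>real j * \<alpha> - real j * (of_int p / real q)\<bar> = real j * \<bar>\<alpha> - of_int p / real q\<bar>"
        unfolding right_diff_distrib[symmetric] by (simp add: abs_mult)
      also have "\<dots> \<le> real q * (1 / (2 * (real q)\<^sup>2))"
        using approx True by (intro mult_mono) auto
      also have "\<dots> = 1 / (2 * real q)" by (simp add: power2_eq_square)
      finally have 2: "\<bar>real j * \<alpha> - real j * (of_int p / real q)\<bar> \<le> 1 / (2 * real q)" .
      have 3: "1 / real q = 1 / (2 * real q) + 1 / (2 * real q)" by (simp add: field_simps)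
      have "d \<le> \<bar>z - w\<bar>" if "e \<le> \<bar>y - w\<bar>" "\<bar>z - y\<bar> \<le> d" "e = d + d" for d e y z w :: real
        using that by linarith
      from this[OF 1 2 3] show ?thesis .
    qed
    then have "2 * (1 / (2 * real q)) \<le> \<bar>sin (pi * (real j * \<alpha>))\<bar>"
      by (rule abs_sin_pi_ge)
    then have "2 * (1 / real q) * (real q)\<^sup>2 \<le> 2 * \<bar>sin (pi * (real j * \<alpha>))\<bar> * (real q)\<^sup>2"
      by (intro mult_right_mono) auto
    moreover have "2 * (1 / real q) * (real q)\<^sup>2 = 2 * real q"
      using assms(2) by (simp add: power2_eq_square)
    ultimately show ?thesis by linarith
  qed simp
qed simp

section \<open>Lower and upper growth exponents\<close>

lemma Liminf_at_top_le_subsequence: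
  fixes g :: "real \<Rightarrow> ereal"
  assumes "filterlim x at_top sequentially" "u \<longlonglongrightarrow> l"
    and "eventually (\<lambda>n. g (x n) \<le> u n) sequentially"
  shows "Liminf at_top g \<le> l"
proof -
  have "Liminf at_top g \<le> Liminf sequentially (\<lambda>n. g (x n))"
    unfolding le_Liminf_iff
    using assms(1) by (auto dest!: less_LiminfD elim: eventually_compose_filterlim)
  also have "\<dots> \<le> Liminf sequentially u" using assms(3) by (rule Liminf_mono)
  also have "\<dots> = l" using assms(2) by (simp add: lim_imp_Liminf)
  finally show ?thesis .
qed

lemma subsequence_le_Limsup_at_top:
  fixes g :: "real \<Rightarrow> ereal"
  assumes "filterlim x at_top sequentially" "u \<longlonglongrightarrow> l"
    and "eventually (\<lambda>n. u n \<le> g (x n)) sequentially"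
  shows "l \<le> Limsup at_top g"
proof -
  have "l = Limsup sequentially u" using assms(2) by (simp add: lim_imp_Limsup)
  also have "\<dots> \<le> Limsup sequentially (\<lambda>n. g (x n))" using assms(3) by (rule Limsup_mono)
  also have "\<dots> \<le> Limsup at_top g"
    unfolding Limsup_le_iff
    using assms(1) by (auto dest!: Limsup_lessD elim: eventually_compose_filterlim)
  finally show ?thesis .
qed

lemma tendsto_const_divide_ln: "((\<lambda>r. C / ln r) \<longlongrightarrow> (0::real)) at_top"
  by (intro tendsto_divide_0[OF tendsto_const] filterlim_at_top_imp_at_infinity ln_at_top)

lemma Limsup_boundary_exponent_le:
  assumes "0 < \<epsilon>"
  shows "Limsup at_top (\<lambda>r. ereal (ln (boundary_fun \<epsilon> \<alpha> r) / ln r)) \<le> ereal (1/2)"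
proof -
  define C where "C = cusp_const \<epsilon> * (2 * pi + 2)"
  have C: "0 < C" using cusp_const_pos[OF assms] pi_gt_zero by (simp add: C_def add_pos_pos)
  have "((\<lambda>r. ln C / ln r + 1/2) \<longlongrightarrow> 0 + 1/2) at_top"
    by (intro tendsto_intros tendsto_const_divide_ln)
  then have lim: "((\<lambda>r. ereal (ln C / ln r + 1/2)) \<longlongrightarrow> ereal (1/2)) at_top" by simp
  have "eventually (\<lambda>r. ereal (ln (boundary_fun \<epsilon> \<alpha> r) / ln r) \<le> ereal (ln C / ln r + 1/2)) at_top"
    using eventually_gt_at_top[of 1]
  proof eventually_elim
    case (elim r)
    have "0 < boundary_fun \<epsilon> \<alpha> r"
      using elim by (intro boundary_fun_pos assms) auto
    then have "ln (boundary_fun \<epsilon> \<alpha> r) \<le> ln (C * sqrt r)"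
      using boundary_fun_le_sqrt[OF assms, of r \<alpha>] elim C unfolding C_def by (subst ln_le_cancel_iff) auto
    also have "\<dots> = ln C + ln r / 2" using C elim by (simp add: ln_mult ln_sqrt)
    finally show ?case using elim by (simp add: field_simps)
  qed
  then have "Limsup at_top (\<lambda>r. ereal (ln (boundary_fun \<epsilon> \<alpha> r) / ln r))
      \<le> Limsup at_top (\<lambda>r. ereal (ln C / ln r + 1/2))" by (rule Limsup_mono)
  also have "\<dots> = ereal (1/2)" using lim by (simp add: lim_imp_Limsup)
  finally show ?thesis .
qed

lemma Liminf_boundary_exponent_nonneg:
  assumes "0 < \<epsilon>"
  shows "0 \<le> Liminf at_top (\<lambda>r. ereal (ln (boundary_fun \<epsilon> \<alpha> r) / ln r))"
proof -
  have "((\<lambda>r. ereal (ln (cusp_const \<epsilon>) / ln r)) \<longlongrightarrow> ereal 0) at_top"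
    using tendsto_const_divide_ln by simp
  then have "0 = Liminf at_top (\<lambda>r. ereal (ln (cusp_const \<epsilon>) / ln r))"
    unfolding zero_ereal_def by (intro lim_imp_Liminf[symmetric]) auto
  also have "\<dots> \<le> Liminf at_top (\<lambda>r. ereal (ln (boundary_fun \<epsilon> \<alpha> r) / ln r))"
  proof (rule Liminf_mono)
    show "eventually (\<lambda>r. ereal (ln (cusp_const \<epsilon>) / ln r) \<le> ereal (ln (boundary_fun \<epsilon> \<alpha> r) / ln r)) at_top"
      using eventually_gt_at_top[of 1]
    proof eventually_elim
      case (elim r)
      have "ln (cusp_const \<epsilon>) \<le> ln (boundary_fun \<epsilon> \<alpha> r)"
        using cusp_const_le_boundary_fun[OF assms, of r \<alpha>] cusp_const_pos[OF assms] elim by simp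
      then show ?case using elim by (simp add: divide_right_mono)
    qed
  qed
  finally show ?thesis .
qed

text \<open>At \<open>r = q\<^sup>2\<close> for a denominator \<open>q\<close>, the lower bound \<open>c q\<close> equals \<open>c sqrt r\<close>, and the constant
  \<open>c\<close> disappears in the quotient of logarithms as \<open>q\<close> grows.\<close>
lemma Limsup_boundary_exponent_ge:
  fixes p :: "nat \<Rightarrow> int" and q :: "nat \<Rightarrow> nat"
  assumes "0 < \<epsilon>" and q: "filterlim q at_top sequentially"
    and coprime: "\<And>n. coprime (p n) (int (q n))"
    and approx: "\<And>n. \<bar>\<alpha> - of_int (p n) / real (q n)\<bar> \<le> 1 / (2 * (real (q n))\<^sup>2)"
  shows "ereal (1/2) \<le> Limsup at_top (\<lambda>r. ereal (ln (boundary_fun \<epsilon> \<alpha> r) / ln r))"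
proof (rule subsequence_le_Limsup_at_top)
  have q': "filterlim (\<lambda>n. real (q n)) at_top sequentially"
    by (rule filterlim_compose[OF filterlim_real_sequentially q])
  show X: "filterlim (\<lambda>n. (real (q n))\<^sup>2) at_top sequentially"
    using q' by (simp add: filterlim_pow_at_top)
  have "(\<lambda>n. ln (cusp_const \<epsilon>) / ln ((real (q n))\<^sup>2) + 1/2) \<longlonglongrightarrow> 0 + 1/2"
    by (intro tendsto_intros filterlim_compose[OF tendsto_const_divide_ln X])
  then show "(\<lambda>n. ereal (ln (cusp_const \<epsilon>) / ln ((real (q n))\<^sup>2) + 1/2)) \<longlonglongrightarrow> ereal (1/2)" by simp
  have "eventually (\<lambda>n. 1 < real (q n)) sequentially"
    using q' unfolding filterlim_at_top_dense by blast
  then show "eventually (\<lambda>n. ereal (ln (cusp_const \<epsilon>) / ln ((real (q n))\<^sup>2) + 1/2)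
      \<le> ereal (ln (boundary_fun \<epsilon> \<alpha> ((real (q n))\<^sup>2)) / ln ((real (q n))\<^sup>2))) sequentially"
  proof eventually_elim
    case (elim n)
    have lnq: "ln ((real (q n))\<^sup>2) = 2 * ln (real (q n))" using elim by (simp add: ln_realpow)
    have "ln (cusp_const \<epsilon>) + ln (real (q n)) = ln (cusp_const \<epsilon> * real (q n))"
      using cusp_const_pos[OF assms(1)] elim by (simp add: ln_mult)
    also have "\<dots> \<le> ln (boundary_fun \<epsilon> \<alpha> ((real (q n))\<^sup>2))"
      using boundary_fun_square_ge[OF assms(1) _ coprime approx, of n] cusp_const_pos[OF assms(1)] elim
      by (intro ln_mono) auto
    finally have "(ln (cusp_const \<epsilon>) + ln (real (q n))) / (2 * ln (real (q n)))
        \<le> ln (boundary_fun \<epsilon> \<alpha> ((real (q n))\<^sup>2)) / (2 * ln (real (q n)))"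
      using elim by (intro divide_right_mono) auto
    then show ?case using elim unfolding lnq by (simp add: add_divide_distrib)
  qed
qed

text \<open>Evaluate at \<open>r = q^(n + 1)\<close>, where \<open>q\<close> is the \<open>n\<close>-th denominator. The term \<open>j = q\<close> of the
  infimum has \<open>\<parallel>q \<alpha>\<parallel> r \<le> 1\<close>, so it is of order \<open>q\<close>, while \<open>ln r = (n + 1) ln q\<close>.\<close>
lemma Liminf_boundary_exponent_le:
  fixes p :: "nat \<Rightarrow> int" and q :: "nat \<Rightarrow> nat"
  assumes "0 < \<epsilon>" and q: "\<And>n. 2 \<le> q n"
    and approx: "\<And>n. \<bar>\<alpha> - of_int (p n) / real (q n)\<bar> \<le> 1 / real (q n) ^ (n + 2)"
  shows "Liminf at_top (\<lambda>r. ereal (ln (boundary_fun \<epsilon> \<alpha> r) / ln r)) \<le> 0"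
proof (rule Liminf_at_top_le_subsequence)
  define C where "C = cusp_const \<epsilon> * (2 * pi + 1)"
  have C: "0 < C" using cusp_const_pos[OF assms(1)] pi_gt_zero by (simp add: C_def add_pos_pos)
  let ?X = "\<lambda>n. real (q n) ^ (n + 1)"
  show "filterlim ?X at_top sequentially"
  proof (rule filterlim_at_top_mono)
    show "filterlim (\<lambda>n. real n) at_top sequentially" by (rule filterlim_real_sequentially)
    have "real n \<le> real (q n) ^ (n + 1)" for n
    proof -
      have "real n \<le> 2 ^ (n + 1)" using of_nat_less_two_power[of "n + 1", where 'a = real] by linarith
      also have "\<dots> \<le> real (q n) ^ (n + 1)" using q[of n] by (intro power_mono) auto
      finally show ?thesis .
    qed
    then show "eventually (\<lambda>n. real n \<le> ?X n) sequentially" by simp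
  qed
  \<comment> \<open>With \<open>x = q n \<ge> 2\<close>, the bound \<open>ln (C x) \<le> K ln x\<close> absorbs the constant \<open>C\<close>.\<close>
  define K where "K = \<bar>ln C\<bar> / ln 2 + 1"
  have "(\<lambda>n. K / real (n + 1)) \<longlonglongrightarrow> 0" using LIMSEQ_Suc[OF lim_const_over_n[of K]] by simp
  then have "(\<lambda>n. ereal (K / real (n + 1))) \<longlonglongrightarrow> ereal 0" by (rule tendsto_ereal)
  then show "(\<lambda>n. ereal (K / real (n + 1))) \<longlonglongrightarrow> 0" by (simp only: zero_ereal_def)
  have "ln (boundary_fun \<epsilon> \<alpha> (?X n)) / ln (?X n) \<le> K / real (n + 1)" for n
  proof -
    define x where "x = real (q n)"
    have x: "2 \<le> x" using q[of n] by (simp add: x_def)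
    have "\<bar>x * \<alpha> - of_int (p n)\<bar> * x ^ (n + 1) \<le> 1"
    proof -
      have "x * \<alpha> - of_int (p n) = x * (\<alpha> - of_int (p n) / x)" using x by (simp add: field_simps)
      then have "\<bar>x * \<alpha> - of_int (p n)\<bar> * x ^ (n + 1) = \<bar>\<alpha> - of_int (p n) / x\<bar> * x ^ (n + 2)"
        using x by (simp add: abs_mult mult_ac)
      also have "\<dots> \<le> 1" using approx[of n] x by (simp add: x_def[symmetric] field_simps)
      finally show ?thesis .
    qed
    then have "2 * pi * (\<bar>x * \<alpha> - of_int (p n)\<bar> * x ^ (n + 1)) + x \<le> 2 * pi * 1 + x"
      by (intro add_right_mono mult_left_mono) auto
    also have "\<dots> \<le> 2 * pi * x + x" using x by simp
    finally have "2 * pi * (\<bar>x * \<alpha> - of_int (p n)\<bar> * x ^ (n + 1)) + x \<le> (2 * pi + 1) * x"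
      by (simp add: algebra_simps)
    from mult_left_mono[OF this less_imp_le[OF cusp_const_pos[OF assms(1)]]]
    have "cusp_const \<epsilon> * (2 * pi * \<bar>x * \<alpha> - of_int (p n)\<bar> * x ^ (n + 1) + x) \<le> C * x"
      unfolding C_def by (simp only: mult.assoc)
    moreover have "boundary_fun \<epsilon> \<alpha> (x ^ (n + 1))
        \<le> cusp_const \<epsilon> * (2 * pi * \<bar>x * \<alpha> - of_int (p n)\<bar> * x ^ (n + 1) + x)"
      using q[of n] unfolding x_def by (intro boundary_fun_le assms) auto
    ultimately have "boundary_fun \<epsilon> \<alpha> (x ^ (n + 1)) \<le> C * x" by linarith
    moreover have "0 < boundary_fun \<epsilon> \<alpha> (x ^ (n + 1))"
      using x by (intro boundary_fun_pos assms zero_le_power) auto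
    ultimately have "ln (boundary_fun \<epsilon> \<alpha> (x ^ (n + 1))) \<le> ln (C * x)"
      by (intro ln_mono)
    also have "\<dots> = ln C + ln x" using C x by (simp add: ln_mult)
    also have "\<dots> \<le> K * ln x"
    proof -
      have "\<bar>ln C\<bar> / ln 2 * ln 2 \<le> \<bar>ln C\<bar> / ln 2 * ln x"
        using x by (intro mult_left_mono) auto
      then show ?thesis unfolding K_def by (simp add: distrib_right)
    qed
    finally have "ln (boundary_fun \<epsilon> \<alpha> (x ^ (n + 1))) \<le> K * ln x" .
    moreover have "ln (x ^ (n + 1)) = real (n + 1) * ln x" using x by (subst ln_realpow) auto
    moreover have "0 < ln x" using x by simp
    ultimately show ?thesis unfolding x_def[symmetric]
      by (simp add: divide_simps del: of_nat_Suc of_nat_add power_Suc)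
  qed
  then show "eventually (\<lambda>n. ereal (ln (boundary_fun \<epsilon> \<alpha> (?X n)) / ln (?X n)) \<le> ereal (K / real (n + 1))) sequentially"
    by simp
qed

text \<open>At a rational number with denominator \<open>b\<close>, the sine in the term \<open>j = b\<close> vanishes, so the
  boundary function is bounded.\<close>
lemma irrational_if_Limsup_boundary_exponent_pos:
  assumes "0 < \<epsilon>" and "0 < Limsup at_top (\<lambda>r. ereal (ln (boundary_fun \<epsilon> \<alpha> r) / ln r))"
  shows "\<alpha> \<notin> \<rat>"
proof
  assume "\<alpha> \<in> \<rat>"
  then obtain a :: int and b :: nat where "0 < b" and ab: "\<alpha> = of_int a / real b"
    by (metis Rats_cases' of_int_of_nat_eq zero_less_imp_eq_int of_nat_0_less_iff)
  define D where "D = ln (cusp_const \<epsilon> * real b)"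
  have "eventually (\<lambda>r. ereal (ln (boundary_fun \<epsilon> \<alpha> r) / ln r) \<le> ereal (D / ln r)) at_top"
    using eventually_gt_at_top[of 1]
  proof eventually_elim
    case (elim r)
    have "boundary_fun \<epsilon> \<alpha> r \<le> cusp_const \<epsilon> * real b"
      using boundary_fun_le[OF assms(1), of b r \<alpha> a] \<open>0 < b\<close> elim by (simp add: ab)
    moreover have "0 < boundary_fun \<epsilon> \<alpha> r"
      using elim by (intro boundary_fun_pos assms) auto
    ultimately have "ln (boundary_fun \<epsilon> \<alpha> r) \<le> D" unfolding D_def by (intro ln_mono)
    then show ?case using elim by (simp add: divide_right_mono)
  qed
  then have "Limsup at_top (\<lambda>r. ereal (ln (boundary_fun \<epsilon> \<alpha> r) / ln r)) \<le> Limsup at_top (\<lambda>r. ereal (D / ln r))"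
    by (rule Limsup_mono)
  also have "\<dots> = ereal 0"
    by (rule lim_imp_Limsup) (use tendsto_const_divide_ln[of D] in auto)
  finally show False using assms(2) by (simp add: zero_ereal_def)
qed

section \<open>A Liouville number\<close>

definition liouville_number :: real where
  "liouville_number = suminf (\<lambda>i. (1/2) ^ fact (Suc i))"

text \<open>The last summand contributes \<open>1\<close> to the numerator over the denominator \<open>2^(k + 1)!\<close>, and all
  earlier ones contribute even numbers. So the partial sums are reduced fractions.\<close>
lemma liouville_partial_sum_odd:
  "\<exists>p::int. odd p \<and> (\<Sum>i<Suc k. (1/2::real) ^ fact (Suc i)) = of_int p / 2 ^ fact (Suc k)"
proof (induction k)
  case 0
  show ?case by (intro exI[of _ 1]) simp
next
  case (Suc k)
  then obtain p :: int where "odd p"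
    and p: "(\<Sum>i<Suc k. (1/2::real) ^ fact (Suc i)) = of_int p / 2 ^ fact (Suc k)" by blast
  define d :: nat where "d = Suc k * fact (Suc k)"
  have d: "fact (Suc (Suc k)) = fact (Suc k) + d" by (simp add: d_def)
  have "0 < d" by (simp add: d_def del: fact_Suc)
  have "(\<Sum>i<Suc (Suc k). (1/2::real) ^ fact (Suc i))
      = of_int p / 2 ^ fact (Suc k) + 1 / 2 ^ fact (Suc (Suc k))"
    using p by (simp add: power_one_over del: fact_Suc)
  also have "\<dots> = of_int (p * 2 ^ d + 1) / 2 ^ fact (Suc (Suc k))"
    unfolding d power_add by (simp add: field_simps del: fact_Suc)
  finally show ?case using \<open>0 < d\<close> by (intro exI[of _ "p * 2 ^ d + 1"]) (simp del: fact_Suc)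
qed

text \<open>Factorials grow at least by one in each step, which makes a geometric series dominate the
  tail of the series.\<close>
lemma fact_add_le: "fact (Suc k) + i \<le> (fact (Suc (i + k)) :: nat)"
proof (induction i)
  case (Suc i)
  have "fact (Suc (i + k)) + 1 \<le> fact (Suc (i + k)) + Suc (i + k) * (fact (Suc (i + k)) :: nat)"
    by (intro add_left_mono) (metis One_nat_def Suc_leI fact_gt_zero nat_0_less_mult_iff zero_less_Suc)
  also have "\<dots> = fact (Suc (Suc i + k))" by simp
  finally show ?case using Suc by linarith
qed simp

lemma liouville_tail:
  "\<bar>liouville_number - (\<Sum>i<k. (1/2) ^ fact (Suc i))\<bar> \<le> 2 / 2 ^ fact (Suc k)"
  and liouville_partial_sum_le: "(\<Sum>i<k. (1/2) ^ fact (Suc i)) \<le> liouville_number"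
proof -
  let ?f = "\<lambda>i. (1/2::real) ^ fact (Suc i)"
  have le: "?f (i + k) \<le> (1/2) ^ fact (Suc k) * (1/2) ^ i" for i k
    unfolding power_add[symmetric] by (rule power_decreasing[OF fact_add_le]) auto
  have geo: "summable (\<lambda>i. (1/2::real) ^ fact (Suc k) * (1/2) ^ i)" for k
    by (intro summable_mult summable_geometric) auto
  have sum: "summable ?f"
    using le[of _ 0] by (intro summable_comparison_test[OF _ geo[of 0]]) auto
  have "liouville_number - (\<Sum>i<k. ?f i) = suminf (\<lambda>i. ?f (i + k))"
    unfolding liouville_number_def by (subst suminf_split_initial_segment[OF sum, of k]) simp
  moreover have "0 \<le> suminf (\<lambda>i. ?f (i + k))"
    by (intro suminf_nonneg summable_ignore_initial_segment[OF sum]) simp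
  moreover have "suminf (\<lambda>i. ?f (i + k)) \<le> suminf (\<lambda>i. (1/2) ^ fact (Suc k) * (1/2) ^ i)"
    by (intro suminf_le[OF le summable_ignore_initial_segment[OF sum] geo])
  moreover have "\<dots> = 2 / 2 ^ fact (Suc k)"
    by (subst suminf_mult) (auto simp: suminf_geometric power_one_over simp del: fact_Suc)
  ultimately show "\<bar>liouville_number - (\<Sum>i<k. ?f i)\<bar> \<le> 2 / 2 ^ fact (Suc k)"
    and "(\<Sum>i<k. ?f i) \<le> liouville_number" by linarith+
qed

lemma liouville_number_bounds: "0 \<le> liouville_number" "liouville_number < 1"
proof -
  show "0 \<le> liouville_number" using liouville_partial_sum_le[of 0] by simp
  \<comment> \<open>The first two terms sum to \<open>1/2 + 1/4\<close>.\<close>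
  have "\<bar>liouville_number - 3/4\<bar> \<le> 2 / 2 ^ 6"
    using liouville_tail[of 2] by (simp add: eval_nat_numeral)
  then have "liouville_number - 3/4 \<le> 2 / 2 ^ 6" by (rule abs_le_D1)
  then show "liouville_number < 1" by simp
qed

text \<open>With \<open>m = (n + 2)!\<close> and the denominator \<open>q = 2^m\<close>, the tail of the series is at most
  \<open>2 / 2^(n + 3)! = 2 / q^(n + 3)\<close>; the spare factor \<open>q \<ge> 4\<close> pays for the constants.\<close>
lemma liouville_approximations:
  obtains p :: "nat \<Rightarrow> int" where
    "\<And>n. coprime (p n) (int (2 ^ fact (n + 2)))"
    "\<And>n. \<bar>liouville_number - of_int (p n) / real (2 ^ fact (n + 2))\<bar>
       \<le> 1 / (2 * real (2 ^ fact (n + 2)) ^ (n + 2))"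
proof -
  have "\<exists>p::int. coprime p (int (2 ^ fact (n + 2))) \<and>
      \<bar>liouville_number - of_int p / real (2 ^ fact (n + 2))\<bar>
       \<le> 1 / (2 * real (2 ^ fact (n + 2)) ^ (n + 2))" for n
  proof -
    obtain p :: int where "odd p"
      and p: "(\<Sum>i<Suc (Suc n). (1/2::real) ^ fact (Suc i)) = of_int p / 2 ^ fact (Suc (Suc n))"
      using liouville_partial_sum_odd[of "Suc n"] by blast
    define m :: nat where "m = fact (n + 2)"
    have "2 \<le> m" using fact_ge_self[of "n + 2"] unfolding m_def by linarith
    have "fact (Suc (n + 2)) = m * (n + 2) + m" by (simp add: m_def)
    then have "\<bar>liouville_number - of_int p / 2 ^ m\<bar> \<le> 2 / 2 ^ (m * (n + 2) + m)"
      using liouville_tail[of "n + 2"] p by (simp add: m_def del: fact_Suc)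
    also have "\<dots> \<le> 2 / 2 ^ (m * (n + 2) + 2)"
      using \<open>2 \<le> m\<close> by (intro divide_left_mono power_increasing) auto
    also have "\<dots> = 1 / (2 * (2 ^ m) ^ (n + 2))" by (simp add: power_add power_mult)
    finally show ?thesis
      using \<open>odd p\<close> unfolding m_def[symmetric] by (intro exI[of _ p]) auto
  qed
  then show thesis using that by metis
qed

theorem theorem4p6:
  fixes \<epsilon> :: real
  assumes "0 < \<epsilon>" and "\<epsilon> \<le> margulis_constant4"
  shows "\<exists>\<alpha>::real. \<alpha> \<in> {0..<1} \<and> \<alpha> \<notin> \<rat> \<and>
    Liminf at_top (\<lambda>r::real. ereal (ln (boundary_fun \<epsilon> \<alpha> r) / ln r)) = 0 \<and>
    (0::ereal) < ereal (1 / 2) \<and>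
    ereal (1 / 2) = Limsup at_top (\<lambda>r::real. ereal (ln (boundary_fun \<epsilon> \<alpha> r) / ln r))"
proof -
  obtain p :: "nat \<Rightarrow> int" where
    coprime: "\<And>n. coprime (p n) (int (2 ^ fact (n + 2)))" and
    approx: "\<And>n. \<bar>liouville_number - of_int (p n) / real (2 ^ fact (n + 2))\<bar>
       \<le> 1 / (2 * real (2 ^ fact (n + 2)) ^ (n + 2))"
    using liouville_approximations by blast
  define q :: "nat \<Rightarrow> nat" where "q = (\<lambda>n. 2 ^ fact (n + 2))"
  have q: "n + 2 \<le> q n" for n
    using fact_ge_self[of "n + 2"] less_exp[of "fact (n + 2)"] unfolding q_def by linarith
  have q_lim: "filterlim q at_top sequentially"
    by (rule filterlim_at_top_mono[OF filterlim_ident]) (simp add: add_leD1[OF q])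
  have cop: "coprime (p n) (int (q n))" for n using coprime by (simp add: q_def)
  have appr: "\<bar>liouville_number - of_int (p n) / real (q n)\<bar> \<le> 1 / (2 * real (q n) ^ (n + 2))" for n
    using approx by (simp add: q_def)
  have appr1: "\<bar>liouville_number - of_int (p n) / real (q n)\<bar> \<le> 1 / real (q n) ^ (n + 2)" for n
    by (rule order_trans[OF appr]) (use q[of n] in \<open>auto intro!: divide_left_mono\<close>)
  have appr2: "\<bar>liouville_number - of_int (p n) / real (q n)\<bar> \<le> 1 / (2 * (real (q n))\<^sup>2)" for n
    by (rule order_trans[OF appr])
      (use q[of n] in \<open>auto intro!: divide_left_mono mult_left_mono power_increasing simp del: power_Suc\<close>)
  have Liminf: "Liminf at_top (\<lambda>r. ereal (ln (boundary_fun \<epsilon> liouville_number r) / ln r)) = 0"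
    using Liminf_boundary_exponent_le[OF assms(1) _ appr1] q Liminf_boundary_exponent_nonneg[OF assms(1)]
    by (metis add_leD2 order_antisym)
  have Limsup: "ereal (1/2) = Limsup at_top (\<lambda>r. ereal (ln (boundary_fun \<epsilon> liouville_number r) / ln r))"
    using Limsup_boundary_exponent_ge[OF assms(1) q_lim cop appr2] Limsup_boundary_exponent_le[OF assms(1)]
    by (rule order_antisym)
  have irrational: "liouville_number \<notin> \<rat>"
    by (rule irrational_if_Limsup_boundary_exponent_pos[OF assms(1)]) (simp flip: Limsup)
  show ?thesis
    using liouville_number_bounds irrational
    by (intro exI[of _ liouville_number] conjI Liminf Limsup) simp_all
qed

end
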